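(* Let $\Omega$ be an open convex subset of $\mathbb{R}^n$ equipped with its tautological weak Finsler structure. Then, for every $x$ and $y$ in $\Omega$, the Euclidean segment connecting $x$ to $y$ is of minimal length (i.e. the affine path from $x$ to $y$ has length equal to $d_\Omega(x,y)$, the infimum of the lengths of all piecewise $C^1$ paths in $\Omega$ from $x$ to $y$), and the associated weak metric on $\Omega$ is given by \[ d_{\Omega}(x,y)=\begin{cases} \displaystyle \log \frac{\vert x-a^+\vert}{\vert y-a^+\vert} & \text{ if } x\neq y \text{ and } R(x,y)\not\subset \Omega,\\ 0 & \text{ otherwise,}\end{cases} \] where, in the first case, $a^+=a^+(x,y)$ is the unique point of $R(x,y)\cap\partial\Omega$.
   Context: $|\cdot|$ is the Euclidean norm on $\mathbb{R}^n$. For distinct points $x,y$, $R(x,y)=\{x+t(y-x) : t\ge 0\}$ is the Euclidean ray starting at $x$ and passing through $y$. For a convex set $\Omega\subset\mathbb{R}^n$ and $x\in\Omega$, the radial function is $r_{\Omega,x}(\xi)=\sup\{t\in\mathbb{R} : x+t\xi\in\Omega\}\in[0,\infty]$ and the Minkowski function of $\Omega$ with respect to $x$ is $p_{\Omega,x}(\xi)=1/r_{\Omega,x}(\xi)$, with $1/\infty=0$. The tautological weak Finsler structure on an open convex set $\Omega$ is $\widetilde\Omega=\{(x,\xi)\in\Omega\times\mathbb{R}^n : x+\xi\in\Omega\}\subset T\Omega\simeq\Omega\times\mathbb{R}^n$. Its Lagrangian (Finsler norm) is $p(x,\xi)=p_{\Omega,x}(\xi)$. The length of a piecewise $C^1$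 path $\gamma:[a,b]\to\Omega$ is $\ell(\gamma)=\int_a^b p(\gamma(t),\dot\gamma(t))\,dt$, and the associated weak metric is $d_\Omega(x,y)=\inf_\gamma \ell(\gamma)$, the infimum being over all piecewise $C^1$ paths in $\Omega$ going from $x$ to $y$. *)

theory Defs
  imports "HOL-Analysis.Analysis"
begin

definition euclidean_ray :: "'a::real_vector \<Rightarrow> 'a \<Rightarrow> 'a set" where
  "euclidean_ray x y = {x + t *\<^sub>R (y - x) | t. 0 \<le> t}"

definition radial_fun :: "'a::real_vector set \<Rightarrow> 'a \<Rightarrow> 'a \<Rightarrow> ereal" where
  "radial_fun \<Omega> x \<xi> = (SUP t\<in>{t::real. x + t *\<^sub>R \<xi> \<in> \<Omega>}. ereal t)"

text \<open>In type \<^typ>\<open>ereal\<close>, \<open>1 / \<infinity> = 0\<close> and \<open>1 / 0 = \<infinity>\<close>; the latter case does not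
  arise when \<open>\<Omega>\<close> is open and \<open>x \<in> \<Omega>\<close>.\<close>

definition minkowski_fun :: "'a::real_vector set \<Rightarrow> 'a \<Rightarrow> 'a \<Rightarrow> ereal" where
  "minkowski_fun \<Omega> x \<xi> = 1 / radial_fun \<Omega> x \<xi>"

definition tautological_structure :: "'a::real_vector set \<Rightarrow> ('a \<times> 'a) set" where
  "tautological_structure \<Omega> = {(x, \<xi>). x \<in> \<Omega> \<and> x + \<xi> \<in> \<Omega>}"

definition tautological_lagrangian :: "'a::real_vector set \<Rightarrow> 'a \<Rightarrow> 'a \<Rightarrow> ereal" where
  "tautological_lagrangian \<Omega> x \<xi> = minkowski_fun \<Omega> x \<xi>"

text \<open>The Lagrangian is, at each point, the Minkowski function of the fibre with respect to
  the origin of the tangent space.\<close>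

lemma tautological_lagrangian_fibre:
  assumes "x \<in> \<Omega>"
  shows "tautological_lagrangian \<Omega> x \<xi> =
    minkowski_fun (tautological_structure \<Omega> `` {x}) 0 \<xi>"
  using assms
  by (simp add: tautological_lagrangian_def minkowski_fun_def radial_fun_def
      tautological_structure_def)

definition C1_on_interval :: "real \<Rightarrow> real \<Rightarrow> (real \<Rightarrow> 'a::real_normed_vector) \<Rightarrow> bool" where
  "C1_on_interval a b \<gamma> \<longleftrightarrow>
    (\<exists>D. continuous_on {a..b} D \<and>
      (\<forall>t\<in>{a..b}. (\<gamma> has_vector_derivative D t) (at t within {a..b})))"

text \<open>Each piece is \<open>C\<^sup>1\<close> up to and including its end points (with one-sided derivatives
  there). The library's \<^const>\<open>piecewise_C1_differentiable_on\<close> is weaker: it requires no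
  one-sided limits of the derivative at the break points.\<close>

definition piecewise_C1_path :: "real \<Rightarrow> real \<Rightarrow> (real \<Rightarrow> 'a::real_normed_vector) \<Rightarrow> bool" where
  "piecewise_C1_path a b \<gamma> \<longleftrightarrow> a < b \<and>
    (\<exists>(k::nat) (s::nat \<Rightarrow> real). s 0 = a \<and> s k = b \<and>
      (\<forall>i<k. s i < s (Suc i) \<and> C1_on_interval (s i) (s (Suc i)) \<gamma>))"

text \<open>At the finitely many break points of a piecewise \<open>C\<^sup>1\<close> path the value of
  \<^const>\<open>vector_derivative\<close> is irrelevant. The integral is taken in \<open>[0,\<infinity>]\<close>, the
  Lagrangian being nonnegative along paths in \<open>\<Omega>\<close>.\<close>

definition finsler_length ::
  "('a \<Rightarrow> 'a \<Rightarrow> ereal) \<Rightarrow> real \<Rightarrow> real \<Rightarrow> (real \<Rightarrow> 'a::real_normed_vector) \<Rightarrow> ennreal" where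
  "finsler_length p a b \<gamma> =
    (\<integral>\<^sup>+ t\<in>{a..b}. e2ennreal (p (\<gamma> t) (vector_derivative \<gamma> (at t within {a..b}))) \<partial>lborel)"

definition finsler_dist ::
  "('a \<Rightarrow> 'a \<Rightarrow> ereal) \<Rightarrow> 'a set \<Rightarrow> 'a \<Rightarrow> 'a::real_normed_vector \<Rightarrow> ennreal" where
  "finsler_dist p \<Omega> x y =
    Inf {finsler_length p a b \<gamma> | a b \<gamma>.
      piecewise_C1_path a b \<gamma> \<and> \<gamma> ` {a..b} \<subseteq> \<Omega> \<and> \<gamma> a = x \<and> \<gamma> b = y}"

definition exit_point :: "'a::real_normed_vector set \<Rightarrow> 'a \<Rightarrow> 'a \<Rightarrow> 'a" where
  "exit_point \<Omega> x y = (THE a. a \<in> euclidean_ray x y \<inter> frontier \<Omega>)"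

end

theory Submission
  imports Defs
begin

text \<open>The proof squeezes the distance between the length of the affine path and a calibration bound.
  Put \<open>\<xi> = y - x\<close>.

  Suppose first that the ray from \<open>x\<close> through \<open>y\<close> leaves \<open>\<Omega>\<close>, at \<open>a = x + T \<xi>\<close> with
  \<open>T > 1\<close> (lemma \<open>exit_time_exists\<close>). Along the affine path the radius in the direction
  \<open>\<xi>\<close> is the remaining time \<open>T - t\<close>, so its length is the integral of \<open>1 / (T - t)\<close> over
  the unit interval, namely \<open>ln (T / (T - 1))\<close>. This is the asserted value, because the vectors
  \<open>x - a\<close> and \<open>y - a\<close> are \<open>- T \<xi>\<close> and \<open>- (T - 1) \<xi>\<close>.

  Conversely, take a hyperplane supporting \<open>\<Omega>\<close> at \<open>a\<close>, say \<open>c \<bullet> w < c \<bullet> a\<close> on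
  \<open>\<Omega>\<close>. Replacing \<open>\<Omega>\<close> by the larger half-space can only decrease the Minkowski function, and for
  the half-space that function is explicit: it is the positive part of
  \<open>(c \<bullet> \<xi>) / (c \<bullet> a - c \<bullet> z)\<close> (lemma \<open>halfspace_le_tautological_lagrangian\<close>). Along any
  path, away from the break points, this quotient is the derivative of \<open>- ln (c \<bullet> a - c \<bullet> \<gamma> t)\<close>, so every path from \<open>x\<close> to
  \<open>y\<close> has length at least \<open>ln ((c \<bullet> a - c \<bullet> x) / (c \<bullet> a - c \<bullet> y))\<close>
  (lemma \<open>finsler_length_ge_ln_halfspace\<close>). As \<open>a\<close>, \<open>x\<close> and \<open>y\<close> are collinear, this is
  again \<open>ln (T / (T - 1))\<close>.

  If the ray stays in \<open>\<Omega>\<close>, or if \<open>x = y\<close>, the radius along the affine path is infinite, the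
  affine path has length \<open>0\<close>, and there is nothing to compare.\<close>

section \<open>Piecewise continuously differentiable paths\<close>

lemma C1_on_interval_imp_continuous_on:
  assumes "C1_on_interval a b \<gamma>"
  shows "continuous_on {a..b} \<gamma>"
  using assms has_vector_derivative_continuous
  unfolding C1_on_interval_def continuous_on_eq_continuous_within by blast

lemma piecewise_C1_path_regularity:
  fixes \<gamma> :: "real \<Rightarrow> 'a::real_normed_vector"
  assumes "piecewise_C1_path a b \<gamma>"
  obtains S where "finite S" and "continuous_on {a..b} \<gamma>"
    and "\<And>t. t \<in> {a<..<b} - S \<Longrightarrow> \<gamma> differentiable (at t)"
proof -
  obtain k s where s: "s 0 = a" "s k = b"
    and less: "\<And>i. i < k \<Longrightarrow> s i < s (Suc i)"
    and C1: "\<And>i. i < k \<Longrightarrow> C1_on_interval (s i) (s (Suc i)) \<gamma>"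
    using assms unfolding piecewise_C1_path_def by blast
  have piece: "\<gamma> differentiable (at t)" if i: "i < k" and t: "t \<in> {s i<..<s (Suc i)}" for i t
  proof -
    obtain D where "(\<gamma> has_vector_derivative D t) (at t within {s i..s (Suc i)})"
      using C1[OF i] t unfolding C1_on_interval_def by fastforce
    then have "(\<gamma> has_vector_derivative D t) (at t)"
      using t by (simp add: at_within_Icc_at)
    then show ?thesis
      by (rule differentiableI_vector)
  qed
  have "i \<le> k \<Longrightarrow> a \<le> s i \<and> continuous_on {a..s i} \<gamma>
      \<and> (\<forall>t\<in>{a<..<s i} - s ` {..i}. \<gamma> differentiable (at t))" for i
  proof (induction i)
    case 0
    then show ?case using s by simp
  next
    case (Suc i)
    then have IH: "a \<le> s i" "continuous_on {a..s i} \<gamma>"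
        "\<forall>t\<in>{a<..<s i} - s ` {..i}. \<gamma> differentiable (at t)" and i: "i < k"
      by auto
    have "continuous_on ({a..s i} \<union> {s i..s (Suc i)}) \<gamma>"
      using IH(2) C1_on_interval_imp_continuous_on[OF C1[OF i]]
      by (intro continuous_on_closed_Un) auto
    moreover have "{a..s i} \<union> {s i..s (Suc i)} = {a..s (Suc i)}"
      using IH(1) less[OF i] by auto
    moreover have "\<gamma> differentiable (at t)"
      if t: "t \<in> {a<..<s (Suc i)} - s ` {..Suc i}" for t
    proof (cases "t < s i")
      case True
      then show ?thesis using IH(3) t by auto
    next
      case False
      moreover have "t \<noteq> s i" using t by auto
      ultimately show ?thesis using piece[OF i] t by auto
    qed
    ultimately show ?case using IH(1) less[OF i] by auto
  qed
  from this[of k] s have "continuous_on {a..b} \<gamma>"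
      "\<forall>t\<in>{a<..<b} - s ` {..k}. \<gamma> differentiable (at t)"
    by auto
  then show ?thesis
    by (intro that[of "s ` {..k}"]) auto
qed

lemma affine_path_has_vector_derivative:
  fixes x \<xi> :: "'a::real_normed_vector"
  shows "((\<lambda>t. x + t *\<^sub>R \<xi>) has_vector_derivative \<xi>) (at t within S)"
  by (auto intro!: derivative_eq_intros)

lemma piecewise_C1_path_affine:
  fixes x \<xi> :: "'a::real_normed_vector"
  shows "piecewise_C1_path 0 1 (\<lambda>t. x + t *\<^sub>R \<xi>)"
  unfolding piecewise_C1_path_def C1_on_interval_def
  by (intro conjI exI[of _ "1::nat"] exI[of _ real])
     (auto intro!: exI[of _ "\<lambda>_. \<xi>"] affine_path_has_vector_derivative continuous_intros)

section \<open>Lower bound for lengths\<close>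

text \<open>By the fundamental theorem of calculus the gauge integral of \<open>g\<close> is the increment, and a
  gauge integrable function is measurable. When the Lebesgue integral of the positive
  part of \<open>g\<close> is finite, it equals the gauge integral of that part, and so dominates the
  gauge integral of \<open>g\<close>.\<close>

lemma increment_le_nn_integral_derivative:
  fixes f g :: "real \<Rightarrow> real"
  assumes "finite S" and "a \<le> b" and "continuous_on {a..b} f"
    and "\<And>t. t \<in> {a<..<b} - S \<Longrightarrow> (f has_real_derivative g t) (at t)"
  shows "ennreal (f b - f a) \<le> (\<integral>\<^sup>+t\<in>{a..b}. ennreal (g t) \<partial>lborel)"
proof -
  let ?M = "lebesgue_on {a..b}"
  have g: "(g has_integral (f b - f a)) {a..b}"
    using assms
    by (intro fundamental_theorem_of_calculus_interior_strong[of S])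
       (auto simp: has_real_derivative_iff_has_vector_derivative)
  then have "g \<in> borel_measurable ?M"
    using integrable_imp_measurable by blast
  then have meas: "(\<lambda>t. max 0 (g t)) \<in> borel_measurable ?M"
    by measurable
  have eq: "(\<integral>\<^sup>+t\<in>{a..b}. ennreal (g t) \<partial>lborel) = (\<integral>\<^sup>+t. ennreal (max 0 (g t)) \<partial>?M)"
  proof -
    have "ennreal (max 0 (g t)) = ennreal (g t)" for t
      by (simp add: max_def ennreal_neg)
    then show ?thesis
      by (simp add: nn_integral_restrict_space nn_integral_completion)
  qed
  show ?thesis
  proof (cases "(\<integral>\<^sup>+t. ennreal (max 0 (g t)) \<partial>?M) = \<infinity>")
    case True
    then show ?thesis using eq by simp
  next
    case False
    then have int: "integrable ?M (\<lambda>t. max 0 (g t))"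
      using meas by (intro integrableI_nonneg) (auto simp: top.not_eq_extremum)
    then have "f b - f a \<le> integral {a..b} (\<lambda>t. max 0 (g t))"
      using g integrable_on_lebesgue_on[OF int]
      by (intro has_integral_le[OF g integrable_integral]) auto
    also have "\<dots> = (\<integral>t. max 0 (g t) \<partial>?M)"
      using int by (simp add: lebesgue_integral_eq_integral)
    finally show ?thesis
      unfolding eq using int by (subst nn_integral_eq_integral) (auto intro: ennreal_leI)
  qed
qed

text \<open>A time \<open>t\<close> with \<open>z + t \<xi>\<close> still in the half-space is at most
  \<open>(\<beta> - c \<bullet> z) / (c \<bullet> \<xi>)\<close> when \<open>c \<bullet> \<xi> > 0\<close>, which bounds the radius of the smaller set
  \<open>\<Omega>\<close>. When \<open>c \<bullet> \<xi> \<le> 0\<close> the left side is \<open>0\<close>, as \<open>ennreal\<close> truncates.\<close>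

lemma halfspace_le_tautological_lagrangian:
  fixes c :: "'a::real_inner"
  assumes half: "\<And>w. w \<in> \<Omega> \<Longrightarrow> c \<bullet> w < \<beta>" and z: "z \<in> \<Omega>"
  shows "ennreal ((c \<bullet> \<xi>) / (\<beta> - c \<bullet> z)) \<le> e2ennreal (tautological_lagrangian \<Omega> z \<xi>)"
proof (cases "c \<bullet> \<xi> > 0")
  case False
  have "(c \<bullet> \<xi>) / (\<beta> - c \<bullet> z) \<le> 0"
    using half[OF z] False by (simp add: divide_nonpos_pos)
  then show ?thesis
    by (simp add: ennreal_neg)
next
  case True
  let ?q = "(\<beta> - c \<bullet> z) / (c \<bullet> \<xi>)"
  define r where "r = radial_fun \<Omega> z \<xi>"
  have "t \<le> ?q" if "z + t *\<^sub>R \<xi> \<in> \<Omega>" for t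
    using half[OF that] True by (simp add: field_simps inner_add_right)
  then have r_le: "r \<le> ereal ?q"
    unfolding r_def radial_fun_def by (intro SUP_least) auto
  have r_ge: "0 \<le> r"
    unfolding r_def radial_fun_def zero_ereal_def using z by (intro SUP_upper) auto
  have "ereal ((c \<bullet> \<xi>) / (\<beta> - c \<bullet> z)) \<le> 1 / r"
  proof (cases r)
    case (real \<rho>)
    have "(c \<bullet> \<xi>) / (\<beta> - c \<bullet> z) \<le> 1 / \<rho>" if "\<rho> > 0"
      using r_le real that True half[OF z] by (simp add: field_simps)
    then show ?thesis
      using real r_ge by (cases "\<rho> = 0") (auto simp: one_ereal_def zero_ereal_def)
  qed (use r_le r_ge in auto)
  then have "e2ennreal (ereal ((c \<bullet> \<xi>) / (\<beta> - c \<bullet> z))) \<le> e2ennreal (1 / r)"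
    by (rule e2ennreal_mono)
  then show ?thesis
    by (simp add: r_def tautological_lagrangian_def minkowski_fun_def e2ennreal_ereal)
qed

lemma finsler_length_ge_ln_halfspace:
  fixes c :: "'a::real_inner"
  assumes half: "\<And>w. w \<in> \<Omega> \<Longrightarrow> c \<bullet> w < \<beta>"
    and \<gamma>: "piecewise_C1_path a b \<gamma>" "\<gamma> ` {a..b} \<subseteq> \<Omega>"
  shows "ennreal (ln ((\<beta> - c \<bullet> \<gamma> a) / (\<beta> - c \<bullet> \<gamma> b)))
    \<le> finsler_length (tautological_lagrangian \<Omega>) a b \<gamma>"
proof -
  define v where "v t = vector_derivative \<gamma> (at t within {a..b})" for t
  define f where "f t = - ln (\<beta> - c \<bullet> \<gamma> t)" for t
  have ab: "a < b"
    using \<gamma>(1) by (simp add: piecewise_C1_path_def)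
  have pos: "0 < \<beta> - c \<bullet> \<gamma> t" if "t \<in> {a..b}" for t
    using half \<gamma>(2) that by fastforce
  obtain S where S: "finite S" and cont: "continuous_on {a..b} \<gamma>"
    and diff: "\<And>t. t \<in> {a<..<b} - S \<Longrightarrow> \<gamma> differentiable (at t)"
    using piecewise_C1_path_regularity[OF \<gamma>(1)] by blast
  have cont_f: "continuous_on {a..b} f"
    unfolding f_def using pos by (intro continuous_intros cont) force
  have deriv_f: "(f has_real_derivative (c \<bullet> v t) / (\<beta> - c \<bullet> \<gamma> t)) (at t)"
    if t: "t \<in> {a<..<b} - S" for t
  proof -
    have "at t within {a..b} = at t"
      using t by (simp add: at_within_Icc_at)
    then have "(\<gamma> has_vector_derivative v t) (at t)"
      using diff[OF t] by (simp add: v_def vector_derivative_works)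
    then have "((\<lambda>t. c \<bullet> \<gamma> t) has_real_derivative c \<bullet> v t) (at t)"
      unfolding has_real_derivative_iff_has_vector_derivative
      by (rule bounded_linear.has_vector_derivative[OF bounded_linear_inner_right])
    then show ?thesis
      unfolding f_def using pos[of t] t
      by (auto intro!: derivative_eq_intros simp: field_simps)
  qed
  have "ln ((\<beta> - c \<bullet> \<gamma> a) / (\<beta> - c \<bullet> \<gamma> b)) = f b - f a"
    using pos[of a] pos[of b] ab by (simp add: f_def ln_div)
  then have "ennreal (ln ((\<beta> - c \<bullet> \<gamma> a) / (\<beta> - c \<bullet> \<gamma> b)))
      \<le> (\<integral>\<^sup>+t\<in>{a..b}. ennreal ((c \<bullet> v t) / (\<beta> - c \<bullet> \<gamma> t)) \<partial>lborel)"
    using increment_le_nn_integral_derivative[OF S less_imp_le[OF ab] cont_f deriv_f] by simp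
  also have "\<dots> \<le> finsler_length (tautological_lagrangian \<Omega>) a b \<gamma>"
    unfolding finsler_length_def v_def[symmetric]
  proof (rule nn_integral_mono)
    fix t :: real
    show "ennreal ((c \<bullet> v t) / (\<beta> - c \<bullet> \<gamma> t)) * indicator {a..b} t
        \<le> e2ennreal (tautological_lagrangian \<Omega> (\<gamma> t) (v t)) * indicator {a..b} t"
    proof (cases "t \<in> {a..b}")
      case True
      then have "\<gamma> t \<in> \<Omega>" using \<gamma>(2) by blast
      then show ?thesis
        using halfspace_le_tautological_lagrangian[of \<Omega> c \<beta>] half by (simp add: mult_right_mono)
    qed simp
  qed
  finally show ?thesis .
qed

section \<open>Rays and exit points\<close>

text \<open>The exit time is the least parameter at which the ray is outside \<open>\<Omega>\<close>. No closure point
  lies beyond it: the half-open segment from the interior point \<open>x\<close> to a closure point stays in the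
  interior, and would contain the point at time \<open>T\<close>.\<close>

lemma exit_time_exists:
  fixes x y :: "'a::euclidean_space"
  assumes "open \<Omega>" and "convex \<Omega>" and "x \<in> \<Omega>" and "y \<in> \<Omega>"
    and ray: "\<not> euclidean_ray x y \<subseteq> \<Omega>"
  obtains T where "1 < T"
    and "\<And>t. 0 \<le> t \<Longrightarrow> x + t *\<^sub>R (y - x) \<in> \<Omega> \<longleftrightarrow> t < T"
    and "euclidean_ray x y \<inter> frontier \<Omega> = {x + T *\<^sub>R (y - x)}"
proof -
  define \<phi> where "\<phi> t = x + t *\<^sub>R (y - x)" for t :: real
  define B where "B = {t. 0 \<le> t \<and> \<phi> t \<notin> \<Omega>}"
  have cont: "continuous_on A \<phi>" for A
    unfolding \<phi>_def by (intro continuous_intros)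
  have "B = {0..} \<inter> \<phi> -` (- \<Omega>)"
    unfolding B_def by auto
  then have "closed B"
    using continuous_closed_preimage[OF cont, of "{0..}" "- \<Omega>"] assms(1)
    by (simp add: closed_Compl)
  moreover have "B \<noteq> {}"
    using ray unfolding B_def \<phi>_def euclidean_ray_def by auto
  moreover have bdd: "bdd_below B"
    unfolding B_def by (intro bdd_belowI[of _ 0]) auto
  ultimately have T: "Inf B \<in> B"
    by (intro closed_contains_Inf)
  define T where "T = Inf B"
  have T0: "0 \<le> T" and T_notin: "\<phi> T \<notin> \<Omega>"
    using T by (auto simp: T_def B_def)
  have below: "\<phi> t \<in> \<Omega>" if "0 \<le> t" "t < T" for t
    using cInf_lower[OF _ bdd, of t] that by (force simp: T_def B_def)
  have beyond: "\<phi> t \<notin> closure \<Omega>" if "T < t" for t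
  proof
    assume "\<phi> t \<in> closure \<Omega>"
    then have "\<phi> t - (1 - T / t) *\<^sub>R (\<phi> t - x) \<in> interior \<Omega>"
      using assms T0 that
      by (intro mem_interior_closure_convex_shrink) (auto simp: interior_open)
    moreover have "\<phi> t - (1 - T / t) *\<^sub>R (\<phi> t - x) = \<phi> T"
      using T0 that by (simp add: \<phi>_def algebra_simps)
    ultimately show False
      using T_notin assms(1) by (simp add: interior_open)
  qed
  have iff: "\<phi> t \<in> \<Omega> \<longleftrightarrow> t < T" if "0 \<le> t" for t
    using below[OF that] beyond[of t] T_notin closure_subset[of \<Omega>]
    by (metis linorder_neqE_linordered_idom subsetD)
  have "1 < T"
    using iff[of 1] assms(4) by (simp add: \<phi>_def)
  have "\<phi> ` closure {0..<T} \<subseteq> closure \<Omega>"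
    using below closure_subset[of \<Omega>] by (intro image_closure_subset cont) auto
  then have "\<phi> T \<in> frontier \<Omega>"
    using \<open>1 < T\<close> T_notin assms(1) by (auto simp: frontier_def interior_open)
  moreover have "t = T" if "0 \<le> t" "\<phi> t \<in> frontier \<Omega>" for t
    using that iff[of t] beyond[of t] assms(1)
    by (cases t T rule: linorder_cases) (auto simp: frontier_def interior_open)
  ultimately have "euclidean_ray x y \<inter> frontier \<Omega> = {\<phi> T}"
    using T0 unfolding euclidean_ray_def \<phi>_def by blast
  then show ?thesis
    using that[of T] \<open>1 < T\<close> iff by (simp add: \<phi>_def)
qed

text \<open>Openness of \<open>\<Omega>\<close> makes the separation strict on that side: a point of \<open>\<Omega>\<close> on the
  hyperplane could be pushed across it in the direction of \<open>c\<close>.\<close>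

lemma open_convex_strict_halfspace:
  fixes a :: "'a::euclidean_space"
  assumes "open \<Omega>" and "convex \<Omega>" and "a \<notin> \<Omega>"
  obtains c where "\<And>w. w \<in> \<Omega> \<Longrightarrow> c \<bullet> w < c \<bullet> a"
proof (cases "\<Omega> = {}")
  case True
  then show ?thesis using that by blast
next
  case False
  then obtain c \<beta> where c: "c \<noteq> 0" "\<forall>w\<in>\<Omega>. c \<bullet> w \<le> \<beta>" "\<beta> \<le> c \<bullet> a"
    using separating_hyperplane_sets[of \<Omega> "{a}"] assms(2,3) by auto
  have "c \<bullet> w < c \<bullet> a" if w: "w \<in> \<Omega>" for w
  proof -
    obtain e where e: "e > 0" "cball w e \<subseteq> \<Omega>"
      using assms(1) w open_contains_cball by blast
    then have "w + (e / norm c) *\<^sub>R c \<in> \<Omega>"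
      using c(1) by (auto simp: dist_norm intro!: subsetD[OF e(2)])
    then have "c \<bullet> w + (e / norm c) * (c \<bullet> c) \<le> \<beta>"
      using c(2) by (auto simp: inner_add_right)
    moreover have "(e / norm c) * (c \<bullet> c) > 0"
      using e(1) c(1) by simp
    ultimately show ?thesis
      using c(3) by linarith
  qed
  then show ?thesis using that by blast
qed

section \<open>The affine path\<close>

lemma finsler_length_affine:
  fixes x \<xi> :: "'a::euclidean_space"
  shows "finsler_length p 0 1 (\<lambda>t. x + t *\<^sub>R \<xi>)
    = (\<integral>\<^sup>+t\<in>{0..1}. e2ennreal (p (x + t *\<^sub>R \<xi>) \<xi>) \<partial>lborel)"
  unfolding finsler_length_def
proof (rule nn_integral_cong)
  fix t :: real
  have "vector_derivative (\<lambda>t. x + t *\<^sub>R \<xi>) (at t within {0..1}) = \<xi>" if "t \<in> {0..1}"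
    using that by (intro vector_derivative_within_closed_interval
        affine_path_has_vector_derivative) auto
  then show "e2ennreal (p (x + t *\<^sub>R \<xi>) (vector_derivative (\<lambda>t. x + t *\<^sub>R \<xi>) (at t within {0..1})))
      * indicator {0..1} t = e2ennreal (p (x + t *\<^sub>R \<xi>) \<xi>) * indicator {0..1} t"
    by (auto simp: indicator_def)
qed

lemma radial_fun_at_exit_time:
  assumes exit: "\<And>s. 0 \<le> s \<Longrightarrow> x + s *\<^sub>R \<xi> \<in> \<Omega> \<longleftrightarrow> s < T" and t: "0 \<le> t" "t < T"
  shows "radial_fun \<Omega> (x + t *\<^sub>R \<xi>) \<xi> = ereal (T - t)"
  unfolding radial_fun_def
proof (rule SUP_eqI)
  have shift: "x + t *\<^sub>R \<xi> + s *\<^sub>R \<xi> = x + (t + s) *\<^sub>R \<xi>" for s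
    by (simp add: algebra_simps)
  fix s assume "s \<in> {s. x + t *\<^sub>R \<xi> + s *\<^sub>R \<xi> \<in> \<Omega>}"
  then show "ereal s \<le> ereal (T - t)"
    using exit[of "t + s"] t by (cases "0 \<le> t + s") (auto simp: shift)
next
  have shift: "x + t *\<^sub>R \<xi> + s *\<^sub>R \<xi> = x + (t + s) *\<^sub>R \<xi>" for s
    by (simp add: algebra_simps)
  fix u assume u: "\<And>s. s \<in> {s. x + t *\<^sub>R \<xi> + s *\<^sub>R \<xi> \<in> \<Omega>} \<Longrightarrow> ereal s \<le> u"
  have u': "ereal s \<le> u" if "0 \<le> s" "s < T - t" for s
    using u[of s] exit[of "t + s"] that t by (auto simp: shift)
  show "ereal (T - t) \<le> u"
  proof (rule dense_le_bounded[of 0])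
    show "0 < ereal (T - t)" using t by simp
    fix w :: ereal assume "0 < w" "w < ereal (T - t)"
    then show "w \<le> u" using u' by (cases w) auto
  qed
qed

lemma finsler_length_affine_exit:
  fixes x \<xi> :: "'a::euclidean_space"
  assumes exit: "\<And>s. 0 \<le> s \<Longrightarrow> x + s *\<^sub>R \<xi> \<in> \<Omega> \<longleftrightarrow> s < T" and T: "1 < T"
  shows "finsler_length (tautological_lagrangian \<Omega>) 0 1 (\<lambda>t. x + t *\<^sub>R \<xi>)
    = ennreal (ln (T / (T - 1)))"
proof -
  have "finsler_length (tautological_lagrangian \<Omega>) 0 1 (\<lambda>t. x + t *\<^sub>R \<xi>)
      = (\<integral>\<^sup>+t\<in>{0..1}. ennreal (1 / (T - t)) \<partial>lborel)"
    unfolding finsler_length_affine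
  proof (rule nn_integral_cong)
    fix t :: real
    have "tautological_lagrangian \<Omega> (x + t *\<^sub>R \<xi>) \<xi> = ereal (1 / (T - t))" if "t \<in> {0..1}"
      using radial_fun_at_exit_time[of x \<xi> \<Omega> T t] exit that T
      by (simp add: tautological_lagrangian_def minkowski_fun_def one_ereal_def)
    then show "e2ennreal (tautological_lagrangian \<Omega> (x + t *\<^sub>R \<xi>) \<xi>) * indicator {0..1} t
        = ennreal (1 / (T - t)) * indicator {0..1} t"
      by (auto simp: indicator_def e2ennreal_ereal)
  qed
  also have "\<dots> = - ln (T - 1) - (- ln (T - 0))"
    using T by (intro nn_integral_FTC_Icc)
      (auto intro!: derivative_eq_intros simp: field_simps has_real_derivative_iff_has_vector_derivative[symmetric])
  also have "- ln (T - 1) - (- ln (T - 0)) = ln (T / (T - 1))"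
    using T by (simp add: ln_div)
  finally show ?thesis .
qed

lemma finsler_length_affine_no_exit:
  fixes x \<xi> :: "'a::euclidean_space"
  assumes ray: "\<And>s. 0 \<le> s \<Longrightarrow> x + s *\<^sub>R \<xi> \<in> \<Omega>"
  shows "finsler_length (tautological_lagrangian \<Omega>) 0 1 (\<lambda>t. x + t *\<^sub>R \<xi>) = 0"
proof -
  have "tautological_lagrangian \<Omega> (x + t *\<^sub>R \<xi>) \<xi> = 0" if "0 \<le> t" for t
  proof -
    have in_\<Omega>: "x + t *\<^sub>R \<xi> + s *\<^sub>R \<xi> \<in> \<Omega>" if "0 \<le> s" for s
      using ray[of "t + s"] that \<open>0 \<le> t\<close> by (simp add: algebra_simps)
    have "ereal (real n) \<le> radial_fun \<Omega> (x + t *\<^sub>R \<xi>) \<xi>" for n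
      unfolding radial_fun_def using in_\<Omega>[of "real n"] by (intro SUP_upper) auto
    then have "radial_fun \<Omega> (x + t *\<^sub>R \<xi>) \<xi> = \<infinity>"
      by (intro ereal_top) (meson ereal_less_eq(3) order_trans real_arch_simple)
    then show ?thesis
      by (simp add: tautological_lagrangian_def minkowski_fun_def)
  qed
  then have "e2ennreal (tautological_lagrangian \<Omega> (x + t *\<^sub>R \<xi>) \<xi>) * indicator {0..1} t = 0" for t
    by (auto simp: indicator_def e2ennreal_neg)
  then show ?thesis
    unfolding finsler_length_affine by (simp only: nn_integral_const) simp
qed

lemma finsler_dist_le_affine:
  fixes x y :: "'a::real_normed_vector"
  assumes "convex \<Omega>" and "x \<in> \<Omega>" and "y \<in> \<Omega>"
  shows "finsler_dist p \<Omega> x y \<le> finsler_length p 0 1 (\<lambda>t. x + t *\<^sub>R (y - x))"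
proof -
  have "x + t *\<^sub>R (y - x) \<in> \<Omega>" if "0 \<le> t" "t \<le> 1" for t
    using convexD_alt[OF assms that] by (simp add: algebra_simps)
  then show ?thesis
    unfolding finsler_dist_def
    by (intro Inf_lower CollectI exI[of _ 0] exI[of _ 1]
        exI[of _ "\<lambda>t. x + t *\<^sub>R (y - x)"] conjI piecewise_C1_path_affine) auto
qed

section \<open>The tautological weak metric\<close>

theorem theorem6p1:
  fixes \<Omega> :: "(real ^ 'n) set" and x y :: "real ^ 'n"
  assumes "open \<Omega>" and "convex \<Omega>" and "x \<in> \<Omega>" and "y \<in> \<Omega>"
  shows "finsler_length (tautological_lagrangian \<Omega>) 0 1 (\<lambda>t. x + t *\<^sub>R (y - x))
      = finsler_dist (tautological_lagrangian \<Omega>) \<Omega> x y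
    \<and> (x \<noteq> y \<and> \<not> euclidean_ray x y \<subseteq> \<Omega> \<longrightarrow>
        (\<exists>!a. a \<in> euclidean_ray x y \<inter> frontier \<Omega>))
    \<and> enn2ereal (finsler_dist (tautological_lagrangian \<Omega>) \<Omega> x y) =
        ereal (if x \<noteq> y \<and> \<not> euclidean_ray x y \<subseteq> \<Omega>
               then ln (norm (x - exit_point \<Omega> x y) / norm (y - exit_point \<Omega> x y))
               else 0)"
proof (cases "x \<noteq> y \<and> \<not> euclidean_ray x y \<subseteq> \<Omega>")
  case False
  then have "x + s *\<^sub>R (y - x) \<in> \<Omega>" if "0 \<le> s" for s
    using assms(3) that by (auto simp: euclidean_ray_def)
  then have "finsler_length (tautological_lagrangian \<Omega>) 0 1 (\<lambda>t. x + t *\<^sub>R (y - x)) = 0"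
    by (rule finsler_length_affine_no_exit)
  then show ?thesis
    using False finsler_dist_le_affine[OF assms(2-4), of "tautological_lagrangian \<Omega>"]
    by (auto simp: zero_ennreal.rep_eq zero_ereal_def)
next
  case True
  let ?L = "tautological_lagrangian \<Omega>"
  obtain T where T: "1 < T"
    and exit: "\<And>t. 0 \<le> t \<Longrightarrow> x + t *\<^sub>R (y - x) \<in> \<Omega> \<longleftrightarrow> t < T"
    and frontier: "euclidean_ray x y \<inter> frontier \<Omega> = {x + T *\<^sub>R (y - x)}"
    using exit_time_exists[OF assms] True by blast
  define a where "a = x + T *\<^sub>R (y - x)"
  have "exit_point \<Omega> x y = a"
    unfolding exit_point_def frontier a_def by simp
  moreover have "x - a = (- T) *\<^sub>R (y - x)" "y - a = (- (T - 1)) *\<^sub>R (y - x)"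
    by (simp_all add: a_def algebra_simps)
  ultimately have value_eq:
      "norm (x - exit_point \<Omega> x y) / norm (y - exit_point \<Omega> x y) = T / (T - 1)"
    using T True by (simp only: norm_scaleR) auto
  have length: "finsler_length ?L 0 1 (\<lambda>t. x + t *\<^sub>R (y - x)) = ennreal (ln (T / (T - 1)))"
    using exit T by (rule finsler_length_affine_exit)
  have "a \<notin> \<Omega>"
    using exit[of T] T by (simp add: a_def)
  then obtain c where c: "\<And>w. w \<in> \<Omega> \<Longrightarrow> c \<bullet> w < c \<bullet> a"
    using open_convex_strict_halfspace[OF assms(1,2)] by blast
  have "c \<bullet> a - c \<bullet> x = T * (c \<bullet> (y - x))" "c \<bullet> a - c \<bullet> y = (T - 1) * (c \<bullet> (y - x))"
    by (simp_all add: a_def inner_simps algebra_simps)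
  \<comment> \<open>The common factor cancels because \<open>c\<close> is nonconstant on the line through \<open>x\<close> and \<open>a\<close>.\<close>
  then have ratio: "(c \<bullet> a - c \<bullet> x) / (c \<bullet> a - c \<bullet> y) = T / (T - 1)"
    using c[OF assms(3)] by auto
  have "ennreal (ln (T / (T - 1))) \<le> finsler_dist ?L \<Omega> x y"
    unfolding finsler_dist_def
  proof (rule Inf_greatest, clarify)
    fix a' b' \<gamma>
    assume "piecewise_C1_path a' b' \<gamma>" "\<gamma> ` {a'..b'} \<subseteq> \<Omega>" "x = \<gamma> a'" "y = \<gamma> b'"
    then show "ennreal (ln (T / (T - 1))) \<le> finsler_length ?L a' b' \<gamma>"
      using finsler_length_ge_ln_halfspace[of \<Omega> c "c \<bullet> a" a' b' \<gamma>] c ratio by simp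
  qed
  then have dist: "finsler_dist ?L \<Omega> x y = ennreal (ln (T / (T - 1)))"
    using finsler_dist_le_affine[OF assms(2-4), of ?L] length by simp
  have "0 \<le> ln (T / (T - 1))"
    using T by simp
  then have "enn2ereal (finsler_dist ?L \<Omega> x y) = ereal (ln (T / (T - 1)))"
    unfolding dist by (rule enn2ereal_ennreal)
  then show ?thesis
    using True length dist value_eq frontier by simp
qed

end
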